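(* For any finite connected graph $G$, $c_H(G) \leq c(G) + \Upsilon(G)$.
   Context: Hyperopic Cops and Robber on a graph $G$ (each vertex considered to carry a loop, so a player may stay put): the cops first occupy a multiset of vertices, then the robber chooses a vertex. In each round, each cop moves to an adjacent vertex or stays, then the robber moves to an adjacent vertex or stays. The robber always sees all cops. The cops see the robber's position except when the robber's vertex is adjacent to every vertex occupied by a cop, in which case the robber is invisible. The robber is captured when a cop occupies the robber's vertex. $c_H(G)$ (the hyperopic cop number) is the minimum number of cops that can guarantee capture in finitely many moves; $c(G)$ is the classical cop number (same game with the robber always visible). $N(v)$ denotes the open neighbourhood of $v$. A non-empty set $S \subseteq V(G)$ is a small common neighbourhood set if $\left|\bigcap_{v\in S} N(v)\right| \le |S|$; $\Upsilon(G)$ is the minimum cardinality of such a set. *)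

theory Defs
  imports "Graph_Theory.Digraph_Component"
begin

text \<open>
  Finite simple graphs are the library's locale \<open>graph\<close>: symmetric, loop-free digraphs without
  parallel arcs. The loops that merely allow a player to stay put are not arcs; they appear only as
  the case \<open>u = v\<close> of \<open>step\<close>.

  The two games differ only in when the cops see the robber, so this condition is a parameter
  \<open>vis\<close>: \<open>vis C r\<close> says that cops placed at \<open>C\<close> see a robber at \<open>r\<close>. A placement of the cops is
  the list of the vertices they occupy (one entry per cop, repetitions allowed).
\<close>

type_synonym 'a visibility = "'a list \<Rightarrow> 'a \<Rightarrow> bool"

definition classical_vis :: "'a visibility" where
  "classical_vis C r \<longleftrightarrow> True"

definition hyperopic_vis :: "('a, 'b) pre_digraph \<Rightarrow> 'a visibility" where
  "hyperopic_vis G C r \<longleftrightarrow> \<not> (\<forall>v \<in> set C. r \<rightarrow>\<^bsub>G\<^esub> v)"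

definition step :: "('a, 'b) pre_digraph \<Rightarrow> 'a \<Rightarrow> 'a \<Rightarrow> bool" where
  "step G u v \<longleftrightarrow> u = v \<or> u \<rightarrow>\<^bsub>G\<^esub> v"

text \<open>
  A play consists of the placements \<open>c 0, c 1, \<dots>\<close> of the cops and the positions \<open>r 0, r 1, \<dots>\<close> of
  the robber, in the order \<open>c 0, r 0, c 1, r 1, \<dots>\<close>.
\<close>

definition robber_play :: "('a, 'b) pre_digraph \<Rightarrow> (nat \<Rightarrow> 'a) \<Rightarrow> bool" where
  "robber_play G r \<longleftrightarrow> r 0 \<in> verts G \<and> (\<forall>n. step G (r n) (r (Suc n)))"

definition cop_play :: "('a, 'b) pre_digraph \<Rightarrow> nat \<Rightarrow> (nat \<Rightarrow> 'a list) \<Rightarrow> bool" where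
  "cop_play G k c \<longleftrightarrow> length (c 0) = k \<and> set (c 0) \<subseteq> verts G \<and>
     (\<forall>n. list_all2 (step G) (c n) (c (Suc n)))"

text \<open>The second disjunct is a capture by a cops' move, before the robber's reply.\<close>

definition captured :: "(nat \<Rightarrow> 'a list) \<Rightarrow> (nat \<Rightarrow> 'a) \<Rightarrow> bool" where
  "captured c r \<longleftrightarrow> (\<exists>n. r n \<in> set (c n) \<or> r n \<in> set (c (Suc n)))"

definition observe :: "'a visibility \<Rightarrow> 'a list \<Rightarrow> 'a \<Rightarrow> 'a option" where
  "observe vis C r = (if vis C r then Some r else None)"

text \<open>
  What the cops have learned about the robber up to and including the robber's \<open>n\<close>-th position.
  The cops look both after their own moves and after those of the robber.
\<close>

primrec observations ::
    "'a visibility \<Rightarrow> (nat \<Rightarrow> 'a list) \<Rightarrow> (nat \<Rightarrow> 'a) \<Rightarrow> nat \<Rightarrow> 'a option list" where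
  "observations vis c r 0 = [observe vis (c 0) (r 0)]"
| "observations vis c r (Suc n) = observations vis c r n @
     [observe vis (c (Suc n)) (r n), observe vis (c (Suc n)) (r (Suc n))]"

text \<open>
  A strategy of the cops maps the list of observations made so far to their next placement; its
  value at \<open>[]\<close> is the initial placement. Their own earlier placements are determined by the
  strategy and the observations, so they need not be further arguments.
\<close>

definition follows ::
    "'a visibility \<Rightarrow> ('a option list \<Rightarrow> 'a list) \<Rightarrow> (nat \<Rightarrow> 'a list) \<Rightarrow> (nat \<Rightarrow> 'a) \<Rightarrow> bool" where
  "follows vis \<sigma> c r \<longleftrightarrow> c 0 = \<sigma> [] \<and> (\<forall>n. c (Suc n) = \<sigma> (observations vis c r n))"

text \<open>
  The robber sees everything and the strategy is deterministic, so guaranteeing capture means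
  capturing the robber along each of his possible walks.
\<close>

definition cops_win :: "('a, 'b) pre_digraph \<Rightarrow> 'a visibility \<Rightarrow> nat \<Rightarrow> bool" where
  "cops_win G vis k \<longleftrightarrow> (\<exists>\<sigma>. \<forall>c r. robber_play G r \<and> follows vis \<sigma> c r \<longrightarrow>
     cop_play G k c \<and> captured c r)"

definition cop_number :: "('a, 'b) pre_digraph \<Rightarrow> nat" where
  "cop_number G = (LEAST k. cops_win G classical_vis k)"

definition hyperopic_cop_number :: "('a, 'b) pre_digraph \<Rightarrow> nat" where
  "hyperopic_cop_number G = (LEAST k. cops_win G (hyperopic_vis G) k)"

definition open_neighbourhood :: "('a, 'b) pre_digraph \<Rightarrow> 'a \<Rightarrow> 'a set" where
  "open_neighbourhood G v = {u. v \<rightarrow>\<^bsub>G\<^esub> u}"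

definition small_common_neighbourhood_set :: "('a, 'b) pre_digraph \<Rightarrow> 'a set \<Rightarrow> bool" where
  "small_common_neighbourhood_set G S \<longleftrightarrow> S \<noteq> {} \<and> S \<subseteq> verts G \<and>
     card (\<Inter>v\<in>S. open_neighbourhood G v) \<le> card S"

definition Upsilon :: "('a, 'b) pre_digraph \<Rightarrow> nat" where
  "Upsilon G = (LEAST n. \<exists>S. small_common_neighbourhood_set G S \<and> card S = n)"

text \<open>On a finite non-empty graph, the three minima above range over non-empty sets.\<close>

lemma cops_win_card_verts:
  assumes "finite (verts G)"
  shows "cops_win G vis (card (verts G))"
proof -
  obtain xs where xs: "set xs = verts G" "length xs = card (verts G)"
    using assms by (metis distinct_card finite_distinct_list)
  have "cop_play G (card (verts G)) c \<and> captured c r"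
    if "robber_play G r" "follows vis (\<lambda>_. xs) c r" for c r
  proof -
    have c: "c n = xs" for n
      using that(2) by (cases n) (auto simp: follows_def)
    show ?thesis
      using that(1) xs
      by (simp add: c cop_play_def captured_def robber_play_def step_def list_all2_same) blast
  qed
  then show ?thesis
    unfolding cops_win_def by blast
qed

lemma (in graph) small_common_neighbourhood_set_verts:
  assumes "verts G \<noteq> {}"
  shows "small_common_neighbourhood_set G (verts G)"
proof -
  obtain v where v: "v \<in> verts G"
    using assms by blast
  have "u \<notin> (\<Inter>w\<in>verts G. open_neighbourhood G w)" for u
  proof
    assume *: "u \<in> (\<Inter>w\<in>verts G. open_neighbourhood G w)"
    then have "v \<rightarrow>\<^bsub>G\<^esub> u"
      using v unfolding open_neighbourhood_def by blast
    then have "u \<in> verts G"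
      by (rule adj_in_verts(2))
    then have "u \<rightarrow>\<^bsub>G\<^esub> u"
      using * unfolding open_neighbourhood_def by blast
    then show False
      using adj_not_same by blast
  qed
  then have "(\<Inter>w\<in>verts G. open_neighbourhood G w) = {}"
    by blast
  then show ?thesis
    using assms by (simp add: small_common_neighbourhood_set_def)
qed

end

theory Submission
  imports Defs
begin

text \<open>
  Post one cop on each vertex of a small common neighbourhood set \<open>S\<close> and let the other cops play a
  winning strategy of the classical game, using only what is seen after the robber's own moves.
  As long as the robber is visible then, the classical strategy proceeds and eventually wins. Once
  he is not, he is adjacent to all of \<open>S\<close>, and as every vertex of \<open>S\<close> is adjacent to the whole common
  neighbourhood, the cops on \<open>S\<close> can occupy all of it in their next move.
\<close>

lemma length_observations: "length (observations vis c r n) = 2 * n + 1"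
  by (induction n) auto

lemma observations_nth_even:
  "i \<le> n \<Longrightarrow> observations vis c r n ! (2 * i) = observe vis (c i) (r i)"
proof (induction n)
  case (Suc n)
  then show ?case
    by (cases "i = Suc n") (auto simp: nth_append length_observations)
qed simp

text \<open>Even indices hold what is seen after the robber's own moves. Rounding up turns the
  length \<open>2 * n + 1\<close> into \<open>n + 1\<close> entries, and \<open>[]\<close>, where
  the initial placement is chosen, into none.\<close>

definition robber_observations :: "'a option list \<Rightarrow> 'a option list" where
  "robber_observations xs = map (\<lambda>i. xs ! (2 * i)) [0..<Suc (length xs) div 2]"

lemma robber_observations_Nil [simp]: "robber_observations [] = []"
  by (simp add: robber_observations_def)

lemma robber_observations_observations:
  "robber_observations (observations vis c r n) =
     map (\<lambda>i. observe vis (c i) (r i)) [0..<Suc n]"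
  by (auto simp: robber_observations_def length_observations observations_nth_even
      simp del: upt_Suc)

text \<open>
  In the classical game a position of the robber is observed after his move and again after the
  cops' reply; the latter is still missing for his last position.
\<close>

definition repeat_observations :: "'a option list \<Rightarrow> 'a option list" where
  "repeat_observations xs = butlast (concat (map (\<lambda>x. [x, x]) xs))"

lemma observations_classical:
  "observations classical_vis c r n = repeat_observations (map (\<lambda>i. Some (r i)) [0..<Suc n])"
  by (induction n)
    (auto simp: repeat_observations_def observe_def classical_vis_def butlast_append)

text \<open>Classical observations do not depend on the placements, so the robber's walk alone
  determines the cops' play in closed form. This lets \<sigma> be simulated inside the other
  game.\<close>

lemma follows_classical:
  "follows classical_vis \<sigma> (\<lambda>n. \<sigma> (repeat_observations (map (\<lambda>i. Some (r i)) [0..<n]))) r"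
  by (simp add: follows_def observations_classical repeat_observations_def del: upt_Suc)

lemma takeWhile_map_upt:
  assumes "\<And>i. i < m \<Longrightarrow> P (f i)" and "m < n \<Longrightarrow> \<not> P (f m)" and "m \<le> n"
  shows "takeWhile P (map f [0..<n]) = map f [0..<m]"
  using assms by (intro takeWhile_eq_take_P_nth[THEN trans, of m]) (auto simp: take_map)

text \<open>Every assignment of common neighbours to cops on \<open>s\<close> is a legal move. There
  are enough cops, so the first ones each take one common neighbour and the rest stay.\<close>

lemma (in graph) cover_common_neighbourhood:
  assumes "small_common_neighbourhood_set G (set s)" and "distinct s"
  obtains t where "list_all2 (step G) s t"
    and "(\<Inter>v\<in>set s. open_neighbourhood G v) \<subseteq> set t"
proof -
  let ?N = "\<Inter>v\<in>set s. open_neighbourhood G v"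
  have s: "s \<noteq> []" "card ?N \<le> length s"
    using assms by (auto simp: small_common_neighbourhood_set_def distinct_card)
  \<comment> \<open>Non-emptiness of \<open>s\<close> matters: an intersection over the empty set
    would be the whole type.\<close>
  have "?N \<subseteq> verts G"
    using s(1) by (force simp: open_neighbourhood_def neq_Nil_conv)
  then obtain xs where xs: "set xs = ?N" "length xs = card ?N"
    by (metis distinct_card finite_distinct_list finite_subset finite_verts)
  have "step G (s ! i) ((xs @ drop (length xs) s) ! i)" if "i < length s" for i
  proof (cases "i < length xs")
    case True
    then have "xs ! i \<in> ?N"
      using xs(1) nth_mem by blast
    then show ?thesis
      using that True by (auto simp: nth_append step_def open_neighbourhood_def)
  qed (use that in \<open>simp add: nth_append step_def\<close>)
  then have "list_all2 (step G) s (xs @ drop (length xs) s)"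
    using s(2) xs(2) by (auto simp: list_all2_conv_all_nth)
  then show thesis
    using that xs(1) by auto
qed

lemma (in graph) cops_win_hyperopic:
  assumes win: "cops_win G classical_vis k" and S: "small_common_neighbourhood_set G S"
  shows "cops_win G (hyperopic_vis G) (k + card S)"
proof -
  have "finite S"
    using S finite_subset[OF _ finite_verts] by (simp add: small_common_neighbourhood_set_def)
  then obtain s where s: "set s = S" "distinct s"
    using finite_distinct_list by blast
  obtain t where st: "list_all2 (step G) s t"
    and N: "(\<Inter>v\<in>set s. open_neighbourhood G v) \<subseteq> set t"
    using cover_common_neighbourhood S s by metis
  obtain \<sigma> where \<sigma>:
    "\<And>c r. robber_play G r \<Longrightarrow> follows classical_vis \<sigma> c r \<Longrightarrow> cop_play G k c \<and> captured c r"
    using win unfolding cops_win_def by blast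
  \<comment> \<open>\<open>vs\<close> stops at the first invisible position and never grows again,
    even if the robber reappears. From then on the classical cops stand still and the others remain
    on \<open>t\<close>.\<close>
  define \<tau> where "\<tau> xs =
    (let os = robber_observations xs; vs = takeWhile (\<lambda>x. x \<noteq> None) os
     in \<sigma> (repeat_observations vs) @ (if length vs = length os then s else t))" for xs
  have "cop_play G (k + card S) c \<and> captured c r"
    if r: "robber_play G r" and c: "follows (hyperopic_vis G) \<tau> c r" for c r
  proof -
    \<comment> \<open>The play of \<sigma> in the classical game against the same walk
      \<open>r\<close>.\<close>
    define d where "d n = \<sigma> (repeat_observations (map (\<lambda>i. Some (r i)) [0..<n]))" for n
    have d: "cop_play G k d" "captured d r"
      using \<sigma> r follows_classical unfolding d_def by blast+
    let ?o = "\<lambda>i. observe (hyperopic_vis G) (c i) (r i)"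
    \<comment> \<open>Here \<open>m\<close> is the first invisible moment, or \<open>n\<close> if
      there is none before \<open>n\<close>.\<close>
    have c_eq: "c n = d m @ (if m = n then s else t)"
      if m: "\<And>i. i < m \<Longrightarrow> ?o i \<noteq> None" "m < n \<Longrightarrow> ?o m = None" "m \<le> n" for n m
    proof -
      have os: "c n = (let os = map ?o [0..<n]; vs = takeWhile (\<lambda>x. x \<noteq> None) os
          in \<sigma> (repeat_observations vs) @ (if length vs = length os then s else t))"
        using c by (cases n)
          (simp_all add: follows_def \<tau>_def robber_observations_observations Let_def del: upt_Suc)
      have "takeWhile (\<lambda>x. x \<noteq> None) (map ?o [0..<n]) = map ?o [0..<m]"
        using m by (intro takeWhile_map_upt) auto
      moreover have "map ?o [0..<m] = map (\<lambda>i. Some (r i)) [0..<m]"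
        using m(1) by (intro map_cong refl) (metis atLeastLessThan_iff observe_def set_upt)
      ultimately show ?thesis
        using os by (simp add: d_def)
    qed
    have step_refl: "list_all2 (step G) xs xs" for xs
      by (simp add: list_all2_same step_def)
    have d_step: "list_all2 (step G) (d n) (d (Suc n))" for n
      using d(1) by (simp add: cop_play_def)
    have "c 0 = d 0 @ s"
      using c_eq[of 0 0] by simp
    then have c0: "length (c 0) = k + card S" "set (c 0) \<subseteq> verts G"
      using d(1) S s by (auto simp: cop_play_def small_common_neighbourhood_set_def distinct_card)
    show ?thesis
    proof (cases "\<exists>m. ?o m = None")
      case False
      then have "c n = d n @ s" for n
        using c_eq[of n n] by simp
      then show ?thesis
        using c0 d(2) d_step step_refl
        by (auto simp: cop_play_def captured_def intro: list_all2_appendI)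
    next
      case True
      define m where "m = (LEAST m. ?o m = None)"
      have m: "?o m = None" "\<And>i. i < m \<Longrightarrow> ?o i \<noteq> None"
        using True LeastI_ex[of "\<lambda>m. ?o m = None"] not_less_Least[of _ "\<lambda>m. ?o m = None"]
        unfolding m_def by blast+
      have before: "c n = d n @ s" if "n \<le> m" for n
        using c_eq[of n n] m(2) that by auto
      have after: "c n = d m @ t" if "m < n" for n
        using c_eq[of m n] m that by auto
      \<comment> \<open>Before round \<open>m\<close> the classical play advances; in the move after
        it only the cops on \<open>s\<close> move, to \<open>t\<close>; later nobody moves.\<close>
      have "list_all2 (step G) (c n) (c (Suc n))" for n
        using st d_step step_refl
        by (cases n m rule: linorder_cases)
          (auto simp: before after intro!: list_all2_appendI)
      \<comment> \<open>Being invisible means being adjacent to all of \<open>c m\<close>, which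
        contains \<open>s\<close>.\<close>
      moreover have "r m \<in> set t"
        using m(1) N before[of m]
        by (auto simp: observe_def hyperopic_vis_def open_neighbourhood_def
            intro: graph_symmetric split: if_splits)
      then have "captured c r"
        using after[of "Suc m"] unfolding captured_def by (intro exI[of _ m]) simp
      ultimately show ?thesis
        using c0 by (simp add: cop_play_def)
    qed
  qed
  then show ?thesis
    unfolding cops_win_def by blast
qed

theorem theorem3p3:
  fixes G :: "('a, 'b) pre_digraph"
  assumes "graph G" and "connected G"
  shows "hyperopic_cop_number G \<le> cop_number G + Upsilon G"
proof -
  interpret graph G
    by fact
  \<comment> \<open>Connectivity enters through non-emptiness, which ensures that the minimum in
    \<open>Upsilon\<close> is attained.\<close>
  have "verts G \<noteq> {}"
    using assms(2) by (auto simp: connected_def strongly_connected_def)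
  then have "\<exists>n S. small_common_neighbourhood_set G S \<and> card S = n"
    using small_common_neighbourhood_set_verts by blast
  then obtain S where S: "small_common_neighbourhood_set G S" "card S = Upsilon G"
    unfolding Upsilon_def
    using LeastI_ex[of "\<lambda>n. \<exists>S. small_common_neighbourhood_set G S \<and> card S = n"]
    by blast
  have "cops_win G classical_vis (cop_number G)"
    unfolding cop_number_def using cops_win_card_verts finite_verts by (metis LeastI)
  then have "cops_win G (hyperopic_vis G) (cop_number G + Upsilon G)"
    using cops_win_hyperopic S by metis
  then show ?thesis
    unfolding hyperopic_cop_number_def by (rule Least_le)
qed

end
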